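(* Let $\mathbb{F}$ be an arbitrary field, let $n\ge 3$, let $\widehat q=(q_1,\dots,q_n)$ be a sequence of integers, and let $\boldsymbol{\lambda}=(\lambda_{ijk})\in\boldsymbol{\Lambda}=\mathbb{F}^{n^3}$ be such that $\lambda_{ijk}=0$ whenever $q_i+q_j-q_k<0$. Define $\boldsymbol{\lambda}(\widehat q)\in\boldsymbol{\Lambda}$ by $\lambda(\widehat q)_{ijk}=\lambda_{ijk}$ if $q_i+q_j-q_k=0$ and $\lambda(\widehat q)_{ijk}=0$ otherwise. If $\max_{i,j,k}(q_i+q_j-q_k)<|\mathbb{F}|-1$, then $\boldsymbol{\lambda}(\widehat q)$ is a linear degeneration of $\boldsymbol{\lambda}$.
   Context: $V$ is an $n$-dimensional vector space over $\mathbb{F}$ with a fixed basis $v_1,\dots,v_n$; $G=GL(V)$ acts on $V$ on the left. $\boldsymbol{\Lambda}=\mathbb{F}^{n^3}$ is the space of structure vectors $\boldsymbol{\lambda}=(\lambda_{ijk})_{1\le i,j,k\le n}$; such a vector corresponds to the (not necessarily associative) algebra on $V$ whose bilinear product is $[v_i,v_j]=\sum_k\lambda_{ijk}v_k$. $G$ acts linearly on $\boldsymbol{\Lambda}$ on the right: $\boldsymbol{\lambda}g$ is the structure vector of the product $[u,v]'=g^{-1}[gu,gv]$. This makes $\boldsymbol{\Lambda}$ a right module over the group algebra $\mathbb{F}G$. $\boldsymbol{\lambda}'$ is called a linear degeneration of $\boldsymbol{\lambda}$ if $\boldsymbol{\lambda}'\in\boldsymbol{\lambda}(\mathbb{F}G)$,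 the $G$-submodule generated by $\boldsymbol{\lambda}$. If $\mathbb{F}$ is infinite, the condition on the maximum holds automatically. *)

theory Defs
  imports "HOL-Analysis.Analysis" "HOL-Library.Poly_Mapping"
begin

locale based_vector_space = vector_space scale
  for scale :: "'a::field \<Rightarrow> 'v::ab_group_add \<Rightarrow> 'v" +
  fixes v :: "'n::finite \<Rightarrow> 'v"
  assumes inj_basis: "inj v"
    and independent_basis: "independent (range v)"
    and span_basis: "span (range v) = UNIV"
begin

definition coord :: "'v \<Rightarrow> 'n \<Rightarrow> 'a"
  where "coord x k = representation (range v) x (v k)"

definition bracket :: "'a ^ ('n \<times> 'n \<times> 'n) \<Rightarrow> 'v \<Rightarrow> 'v \<Rightarrow> 'v"
  where "bracket lam x y =
    (\<Sum>i\<in>UNIV. \<Sum>j\<in>UNIV. scale (coord x i * coord y j) (\<Sum>k\<in>UNIV. scale (lam $ (i, j, k)) (v k)))"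

definition structure_vector :: "('v \<Rightarrow> 'v \<Rightarrow> 'v) \<Rightarrow> 'a ^ ('n \<times> 'n \<times> 'n)"
  where "structure_vector p = (\<chi> t. case t of (i, j, k) \<Rightarrow> coord (p (v i) (v j)) k)"

definition GL :: "('v \<Rightarrow> 'v) set"
  where "GL = {g. Vector_Spaces.linear scale scale g \<and> bij g}"

(* The right action of GL(V): the structure vector of the product g^-1 [g x, g y]. *)
definition act :: "'a ^ ('n \<times> 'n \<times> 'n) \<Rightarrow> ('v \<Rightarrow> 'v) \<Rightarrow> 'a ^ ('n \<times> 'n \<times> 'n)"
  where "act lam g = structure_vector (\<lambda>x y. inv g (bracket lam (g x) (g y)))"

(* An element of the group algebra is a finitely supported formal combination of
   elements of GL(V). The index type is all of V => V, with the support restricted to GL. *)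
definition group_algebra :: "(('v \<Rightarrow> 'v) \<Rightarrow>\<^sub>0 'a) set"
  where "group_algebra = {a. Poly_Mapping.keys a \<subseteq> GL}"

definition act_algebra ::
    "'a ^ ('n \<times> 'n \<times> 'n) \<Rightarrow> (('v \<Rightarrow> 'v) \<Rightarrow>\<^sub>0 'a) \<Rightarrow> 'a ^ ('n \<times> 'n \<times> 'n)"
  where "act_algebra lam a = (\<Sum>g\<in>Poly_Mapping.keys a. Poly_Mapping.lookup a g *s act lam g)"

definition linear_degeneration ::
    "'a ^ ('n \<times> 'n \<times> 'n) \<Rightarrow> 'a ^ ('n \<times> 'n \<times> 'n) \<Rightarrow> bool"
  where "linear_degeneration lam' lam \<longleftrightarrow> lam' \<in> act_algebra lam ` group_algebra"

lemma coord_basis: "coord (v i) k = (if i = k then 1 else 0)"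
  unfolding coord_def
  using representation_basis[OF independent_basis, of "v i"] inj_basis
  by (auto simp: inj_eq)

lemma coord_add: "coord (x + y) k = coord x k + coord y k"
  unfolding coord_def
  by (simp add: representation_add independent_basis span_basis)

lemma coord_scale: "coord (scale c x) k = c * coord x k"
  unfolding coord_def
  by (simp add: representation_scale independent_basis span_basis)

lemma coord_sum: "coord (\<Sum>i\<in>I. f i) k = (\<Sum>i\<in>I. coord (f i) k)"
  unfolding coord_def
  by (simp add: representation_sum independent_basis span_basis)

lemma sum_coord: "(\<Sum>k\<in>UNIV. scale (coord x k) (v k)) = x"
proof -
  have "(\<Sum>k\<in>UNIV. scale (coord x k) (v k)) = (\<Sum>b\<in>range v. scale (representation (range v) x b) b)"
    by (simp add: sum.reindex[OF inj_basis] coord_def)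
  also have "\<dots> = x"
    by (rule sum_representation_eq) (auto simp: independent_basis span_basis)
  finally show ?thesis .
qed

lemma bracket_basis: "bracket lam (v i) (v j) = (\<Sum>k\<in>UNIV. scale (lam $ (i, j, k)) (v k))"
proof -
  have "bracket lam (v i) (v j) =
    (\<Sum>i'\<in>UNIV. \<Sum>j'\<in>UNIV. if j' = j then if i' = i then (\<Sum>k\<in>UNIV. scale (lam $ (i, j, k)) (v k)) else 0 else 0)"
    unfolding bracket_def by (intro sum.cong) (auto simp: coord_basis)
  then show ?thesis by simp
qed

lemma bracket_add_left: "bracket lam (x + y) z = bracket lam x z + bracket lam y z"
  by (simp add: bracket_def coord_add distrib_right scale_left_distrib sum.distrib)

lemma bracket_add_right: "bracket lam x (y + z) = bracket lam x y + bracket lam x z"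
  by (simp add: bracket_def coord_add distrib_left scale_left_distrib sum.distrib)

lemma bracket_scale_left: "bracket lam (scale c x) y = scale c (bracket lam x y)"
  by (simp add: bracket_def coord_scale scale_sum_right ac_simps)

lemma bracket_scale_right: "bracket lam x (scale c y) = scale c (bracket lam x y)"
  by (simp add: bracket_def coord_scale scale_sum_right ac_simps)

lemma structure_vector_bracket: "structure_vector (bracket lam) = lam"
  by (auto simp: vec_eq_iff structure_vector_def bracket_basis coord_sum coord_scale coord_basis
      if_distrib cong: if_cong)

end

(* The degenerate structure vector attached to an integer weight q i of each basis vector. *)
definition weight_zero_part :: "('n::finite \<Rightarrow> int) \<Rightarrow> 'a::field ^ ('n \<times> 'n \<times> 'n) \<Rightarrow> 'a ^ ('n \<times> 'n \<times> 'n)"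
  where "weight_zero_part q lam = (\<chi> t. case t of (i, j, k) \<Rightarrow> if q i + q j - q k = 0 then lam $ (i, j, k) else 0)"

end

theory Submission
  imports Defs "HOL-Computational_Algebra.Polynomial"
begin

text \<open>
  The diagonal map with entries \<open>t ^ q i\<close> multiplies the coordinate \<open>(i, j, k)\<close> of a structure
  vector by \<open>t\<close> to the power \<open>q i + q j - q k\<close>. All exponents occurring in \<open>lam\<close> lie in
  \<open>{0..m}\<close>, where \<open>m + 1\<close> is less than the number of field elements, so there are \<open>m + 1\<close> distinct
  nonzero values of \<open>t\<close>. Lagrange interpolation at these points expresses the value of a
  polynomial of degree at most \<open>m\<close> at 0, and the same coefficients extract the component of
  weight 0 from the translates of \<open>lam\<close>.
\<close>

section \<open>Lagrange interpolation over a field\<close>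

definition lagrange_basis :: "'a::field set \<Rightarrow> 'a \<Rightarrow> 'a poly"
  where "lagrange_basis A t = (\<Prod>u\<in>A - {t}. smult (inverse (t - u)) [:- u, 1:])"

lemma poly_lagrange_basis:
  assumes "finite A" "t \<in> A" "x \<in> A"
  shows "poly (lagrange_basis A t) x = (if x = t then 1 else 0)"
proof -
  have "poly (lagrange_basis A t) x = (\<Prod>u\<in>A - {t}. inverse (t - u) * (x - u))"
    by (simp add: lagrange_basis_def poly_prod algebra_simps)
  \<comment> \<open>For \<open>x = t\<close> every factor is 1; for any other \<open>x\<close> in
    \<open>A\<close> the factor at \<open>u = x\<close> vanishes.\<close>
  also have "\<dots> = (if x = t then 1 else 0)"
    using assms by (auto intro!: prod.neutral left_inverse)
  finally show ?thesis .
qed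

lemma degree_lagrange_basis:
  assumes "finite A" "t \<in> A"
  shows "degree (lagrange_basis A t) < card A"
proof -
  have "degree (lagrange_basis A t) \<le>
      (\<Sum>u\<in>A - {t}. degree (smult (inverse (t - u)) [:- u, 1:]))"
    unfolding lagrange_basis_def using assms
    by (intro degree_prod_sum_le[unfolded comp_def]) auto
  also have "\<dots> \<le> (\<Sum>u\<in>A - {t}. 1)"
    by (intro sum_mono) simp
  also have "\<dots> < card A"
    using card_Diff1_less[OF assms] by (simp only: card_eq_sum)
  finally show ?thesis .
qed

text \<open>Both sides have degree below \<open>card A\<close> and agree at all points of
  \<open>A\<close>, so they coincide.\<close>

lemma lagrange_interpolation:
  fixes p :: "'a::field poly"
  assumes "finite A" "degree p < card A"
  shows "(\<Sum>t\<in>A. smult (poly p t) (lagrange_basis A t)) = p"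
proof (rule poly_eqI_degree[of A])
  fix x assume "x \<in> A"
  then show "poly (\<Sum>t\<in>A. smult (poly p t) (lagrange_basis A t)) x = poly p x"
    using assms by (simp add: poly_sum poly_lagrange_basis if_distrib cong: if_cong)
next
  \<comment> \<open>The truncated subtraction is harmless: \<open>degree p < card A\<close> forces
    \<open>card A\<close> to be positive.\<close>
  have "degree (\<Sum>t\<in>A. smult (poly p t) (lagrange_basis A t)) \<le> card A - 1"
  proof (rule degree_sum_le[OF assms(1)])
    fix t assume "t \<in> A"
    then have "degree (lagrange_basis A t) < card A"
      by (rule degree_lagrange_basis[OF assms(1)])
    then show "degree (smult (poly p t) (lagrange_basis A t)) \<le> card A - 1"
      using degree_smult_le[of "poly p t" "lagrange_basis A t"] by linarith
  qed
  then show "degree (\<Sum>t\<in>A. smult (poly p t) (lagrange_basis A t)) < card A"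
    using assms(2) by linarith
qed (fact assms)

text \<open>The weights are the values at 0 of the Lagrange basis polynomials: interpolating the
  monomial of degree \<open>s\<close> on \<open>A\<close> and evaluating at 0 gives
  \<open>0 ^ s\<close>.\<close>

lemma exists_moment_weights:
  fixes A :: "'a::field set"
  assumes "finite A"
  shows "\<exists>c. \<forall>s<card A. (\<Sum>t\<in>A. c t * t ^ s) = (if s = 0 then 1 else 0)"
proof (intro exI allI impI)
  fix s assume "s < card A"
  then have "(\<Sum>t\<in>A. smult (poly (monom 1 s) t) (lagrange_basis A t)) = monom 1 s"
    by (intro lagrange_interpolation assms) (simp add: degree_monom_eq)
  then have "poly (\<Sum>t\<in>A. smult (poly (monom 1 s) t) (lagrange_basis A t)) 0 = poly (monom 1 s) 0"
    by simp
  then show "(\<Sum>t\<in>A. poly (lagrange_basis A t) 0 * t ^ s) = (if s = 0 then 1 else 0)"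
    by (simp add: poly_sum poly_monom mult.commute power_0_left)
qed

section \<open>Diagonal maps and their action on structure vectors\<close>

context based_vector_space
begin

lemma coord_eqI:
  assumes "\<And>k. coord x k = coord y k"
  shows "x = y"
proof -
  have "x = (\<Sum>k\<in>UNIV. scale (coord x k) (v k))"
    by (rule sum_coord[symmetric])
  also have "\<dots> = (\<Sum>k\<in>UNIV. scale (coord y k) (v k))"
    by (simp only: assms)
  also have "\<dots> = y"
    by (rule sum_coord)
  finally show ?thesis .
qed

definition diag :: "('n \<Rightarrow> 'a) \<Rightarrow> 'v \<Rightarrow> 'v"
  where "diag d x = (\<Sum>i\<in>UNIV. scale (d i * coord x i) (v i))"

lemma coord_diag: "coord (diag d x) k = d k * coord x k"
  by (simp add: diag_def coord_sum coord_scale coord_basis if_distrib cong: if_cong)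

lemma diag_basis: "diag d (v i) = scale (d i) (v i)"
  by (rule coord_eqI) (simp add: coord_diag coord_scale coord_basis)

lemma diag_inverse:
  assumes "\<And>i. d i \<noteq> 0"
  shows "diag (\<lambda>i. inverse (d i)) (diag d x) = x" "diag d (diag (\<lambda>i. inverse (d i)) x) = x"
  by (rule coord_eqI, simp add: coord_diag assms)+

lemma inv_diag:
  assumes "\<And>i. d i \<noteq> 0"
  shows "inv (diag d) = diag (\<lambda>i. inverse (d i))"
  by (rule inv_equality) (simp_all add: diag_inverse assms)

lemma diag_in_GL:
  assumes "\<And>i. d i \<noteq> 0"
  shows "diag d \<in> GL"
proof -
  have "Vector_Spaces.linear scale scale (diag d)"
    by (intro Vector_Spaces.linear_iff[THEN iffD2] conjI allI coord_eqI vector_space_axioms)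
      (simp_all add: coord_diag coord_add coord_scale distrib_left mult.left_commute)
  moreover have "bij (diag d)"
    by (rule bijI') (metis diag_inverse(1) assms, metis diag_inverse(2) assms)
  ultimately show ?thesis
    unfolding GL_def by (intro CollectI conjI)
qed

text \<open>Each \<open>v i\<close> is an eigenvector of \<open>diag d\<close>, so bilinearity pulls
  out \<open>d i * d j\<close>, and the inverse map divides the coordinate \<open>k\<close> by
  \<open>d k\<close>.\<close>

lemma act_diag:
  assumes "\<And>i. d i \<noteq> 0"
  shows "act lam (diag d) $ (i, j, k) = d i * d j / d k * lam $ (i, j, k)"
proof -
  have "act lam (diag d) $ (i, j, k) =
      inverse (d k) * coord (bracket lam (scale (d i) (v i)) (scale (d j) (v j))) k"
    by (simp add: act_def structure_vector_def inv_diag[OF assms] coord_diag diag_basis)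
  also have "coord (bracket lam (scale (d i) (v i)) (scale (d j) (v j))) k
      = d i * (d j * coord (bracket lam (v i) (v j)) k)"
    by (simp add: bracket_scale_left bracket_scale_right coord_scale)
  also have "coord (bracket lam (v i) (v j)) k = lam $ (i, j, k)"
    by (simp add: bracket_basis coord_sum coord_scale coord_basis if_distrib cong: if_cong)
  finally show ?thesis
    by (simp add: divide_inverse ac_simps)
qed

section \<open>Closure properties of linear degenerations\<close>

text \<open>Outside its keys \<open>a\<close> has coefficient 0. A common index set is what
  additivity requires, since cancellation can make the keys of a sum smaller than the union of the
  keys.\<close>

lemma act_algebra_superset:
  assumes "finite S" "Poly_Mapping.keys a \<subseteq> S"
  shows "act_algebra lam a = (\<Sum>g\<in>S. Poly_Mapping.lookup a g *s act lam g)"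
  unfolding act_algebra_def using assms
  by (intro sum.mono_neutral_left) (auto simp: in_keys_iff)

lemma act_algebra_add: "act_algebra lam (a + b) = act_algebra lam a + act_algebra lam b"
proof -
  let ?S = "Poly_Mapping.keys a \<union> Poly_Mapping.keys b"
  have "act_algebra lam x = (\<Sum>g\<in>?S. Poly_Mapping.lookup x g *s act lam g)"
    if "x \<in> {a, b, a + b}" for x
    using that Poly_Mapping.keys_add[of a b] by (intro act_algebra_superset) auto
  then show ?thesis
    by (simp add: lookup_add vec.scale_left_distrib sum.distrib)
qed

lemma act_algebra_single: "act_algebra lam (Poly_Mapping.single g c) = c *s act lam g"
  by (subst act_algebra_superset[of "{g}"]) auto

lemma linear_degeneration_0: "linear_degeneration 0 lam"
proof -
  have "act_algebra lam 0 = 0" "0 \<in> group_algebra"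
    by (simp_all add: act_algebra_def group_algebra_def)
  then show ?thesis
    unfolding linear_degeneration_def by (intro image_eqI) simp_all
qed

lemma linear_degeneration_add:
  assumes "linear_degeneration x lam" "linear_degeneration y lam"
  shows "linear_degeneration (x + y) lam"
proof -
  obtain a b where "a \<in> group_algebra" "b \<in> group_algebra"
    and "x = act_algebra lam a" "y = act_algebra lam b"
    using assms by (auto simp: linear_degeneration_def)
  moreover from this have "a + b \<in> group_algebra"
    using Poly_Mapping.keys_add[of a b] by (auto simp: group_algebra_def)
  ultimately show ?thesis
    unfolding linear_degeneration_def by (intro image_eqI[of _ _ "a + b"]) (simp_all add: act_algebra_add)
qed

lemma linear_degeneration_scaled_act:
  assumes "g \<in> GL"
  shows "linear_degeneration (c *s act lam g) lam"
proof -
  have "Poly_Mapping.single g c \<in> group_algebra"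
    using assms by (auto simp: group_algebra_def)
  then show ?thesis
    unfolding linear_degeneration_def by (intro image_eqI) (simp_all add: act_algebra_single)
qed

lemma linear_degeneration_sum:
  assumes "\<And>t. t \<in> A \<Longrightarrow> linear_degeneration (f t) lam"
  shows "linear_degeneration (\<Sum>t\<in>A. f t) lam"
  using assms
  by (induction A rule: infinite_finite_induct)
    (auto intro: linear_degeneration_0 linear_degeneration_add)

text \<open>\<open>A\<close> supplies the interpolation nodes, so finite and infinite fields differ
  only in the choice of \<open>A\<close>.\<close>

lemma linear_degeneration_weight_zero_part:
  fixes q :: "'n \<Rightarrow> int" and A :: "'a set"
  assumes "finite A" "0 \<notin> A"
    and nonneg: "\<And>i j k. q i + q j - q k < 0 \<Longrightarrow> lam $ (i, j, k) = 0"
    and bound: "\<And>i j k. q i + q j - q k < int (card A)"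
  shows "linear_degeneration (weight_zero_part q lam) lam"
proof -
  obtain c where c: "\<And>s. s < card A \<Longrightarrow> (\<Sum>t\<in>A. c t * t ^ s) = (if s = 0 then 1 else 0)"
    using exists_moment_weights[OF assms(1)] by blast
  \<comment> \<open>The integer power \<open>powi\<close> allows negative weights; for nonzero
    \<open>t\<close> the entries are nonzero.\<close>
  define g where "g t = diag (\<lambda>i. t powi q i)" for t
  have coeff: "(\<Sum>t\<in>A. c t *s act lam (g t)) $ (i, j, k) = weight_zero_part q lam $ (i, j, k)"
    for i j k
  \<comment> \<open>The moment identities cover only natural exponents; at a negative weight
    \<open>lam\<close> vanishes, and so do all its translates.\<close>
  proof (cases "q i + q j - q k < 0")
    case True
    have "act lam (g t) $ (i, j, k) = 0" if "t \<in> A" for t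
      using that assms(2) unfolding g_def by (subst act_diag) (auto simp: nonneg[OF True])
    then show ?thesis
      using True by (simp add: weight_zero_part_def)
  next
    case False
    \<comment> \<open>Nothing is truncated in this case, so \<open>s = 0\<close> holds exactly at
      weight 0.\<close>
    define s where "s = nat (q i + q j - q k)"
    have s: "int s = q i + q j - q k" "s < card A"
      using False bound[of i j k] by (auto simp: s_def)
    have "act lam (g t) $ (i, j, k) = t ^ s * lam $ (i, j, k)" if "t \<in> A" for t
    proof -
      have "t \<noteq> 0"
        using that assms(2) by auto
      then have "t powi q i * t powi q j / t powi q k = t powi int s"
        unfolding s by (simp add: power_int_add power_int_diff)
      with \<open>t \<noteq> 0\<close> show ?thesis
        unfolding g_def by (subst act_diag) auto
    qed
    then have "(\<Sum>t\<in>A. c t *s act lam (g t)) $ (i, j, k) = (\<Sum>t\<in>A. c t * t ^ s) * lam $ (i, j, k)"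
      by (simp add: sum_distrib_right mult.assoc)
    also have "\<dots> = (if s = 0 then 1 else 0) * lam $ (i, j, k)"
      using c s by simp
    also have "\<dots> = weight_zero_part q lam $ (i, j, k)"
      using s(1) by (auto simp: weight_zero_part_def)
    finally show ?thesis .
  qed
  have "g t \<in> GL" if "t \<in> A" for t
    unfolding g_def using that assms(2) by (intro diag_in_GL) auto
  then have "linear_degeneration (\<Sum>t\<in>A. c t *s act lam (g t)) lam"
    by (intro linear_degeneration_sum linear_degeneration_scaled_act)
  also have "(\<Sum>t\<in>A. c t *s act lam (g t)) = weight_zero_part q lam"
    using coeff by (auto simp: vec_eq_iff)
  finally show ?thesis .
qed

end

theorem theorem7p2:
  fixes scale :: "'a::field \<Rightarrow> 'v::ab_group_add \<Rightarrow> 'v"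
    and v :: "'n::finite \<Rightarrow> 'v"
    and q :: "'n \<Rightarrow> int"
    and lam :: "'a ^ ('n \<times> 'n \<times> 'n)"
  assumes "based_vector_space scale v"
    and "CARD('n) \<ge> 3"
    and "\<And>i j k. q i + q j - q k < 0 \<Longrightarrow> lam $ (i, j, k) = 0"
    and "finite (UNIV :: 'a set) \<Longrightarrow>
      Max {q i + q j - q k | i j k. True} < int CARD('a) - 1"
  shows "based_vector_space.linear_degeneration scale v (weight_zero_part q lam) lam"
proof -
  interpret based_vector_space scale v by (fact assms(1))
  let ?W = "{q i + q j - q k | i j k. True}"
  have "?W = range (\<lambda>(i, j, k). q i + q j - q k)"
    unfolding image_def by (auto simp: split_paired_Ex)
  then have W: "finite ?W"
    by simp
  have le: "q i + q j - q k \<le> Max ?W" for i j k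
    by (rule Max_ge[OF W]) blast
  obtain A :: "'a set" where A: "finite A" "0 \<notin> A" "Max ?W < int (card A)"
  proof (cases "finite (UNIV :: 'a set)")
    case True
    \<comment> \<open>Over a finite field all nonzero scalars serve as nodes, whence the bound with
      \<open>CARD('a) - 1\<close>.\<close>
    then have "int (card (UNIV - {0 :: 'a})) = int CARD('a) - 1"
      by (simp add: card_Diff_singleton of_nat_diff Suc_leI card_gt_0_iff)
    with True assms(4) show ?thesis
      by (intro that[of "UNIV - {0}"]) auto
  next
    case False
    then have "infinite (UNIV - {0 :: 'a})"
      by simp
    \<comment> \<open>The \<open>+ 1\<close> makes the bound strict; for a negative maximum
      \<open>nat\<close> gives 0, and one node is still enough.\<close>
    then obtain A where "finite A" "card A = nat (Max ?W) + 1" "A \<subseteq> UNIV - {0 :: 'a}"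
      using infinite_arbitrarily_large by blast
    then show ?thesis
      by (intro that[of A]) auto
  qed
  show ?thesis
    by (rule linear_degeneration_weight_zero_part[OF A(1,2) assms(3) le_less_trans[OF le A(3)]])
qed

end
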